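(* Let $s\ge 2$, $h(z)=\sum_{n\ge m}c_nz^n$, $c_n>0$ for $n\ge m+1$, $a>r$, and suppose that $$\frac{r}{a}\le c_{n+m}\Big(\frac{r}{a}\Big)^{n}\le c_{m+s}\Big(\frac{r}{a}\Big)^{s},\qquad 1\le n<s. \tag{1}$$ If $$\inf_{n\ge s+m-1}\frac{c_n}{c_{n+1}}\le \frac{r}{a}\le \inf_{n\ge s+m}\frac{c_n}{c_{n+1}},$$ then $$\Big(\frac1a-a\Big)a^{-m}r^l\big(h(ar)-c_m(ar)^m\big)\le m_{id_m\to A_h^{m,l}}(r,a)-r^{m+l}c_ma\le \Big(\frac{c_{m+s}}{c_{m+1}}\Big(\frac ra\Big)^{s-1}\Big)^{1/2}\Big(\frac1a-a\Big)a^{-m}r^l\big(h(ar)-c_m(ar)^m\big).$$ For $s=2$ and $c_{m+1}=1$, condition (1) is unnecessary.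
   Context: Here $m\ge 0$, $s$ and $l$ are integers, $0\le r<1$, $c_n\ge 0$ for all $n$, $\mathbb{D}=\{|z|<1\}$, $\|f\|_\infty=\sup_{z\in\mathbb{D}}|f(z)|$, and the power series $h$ converges in some disk of positive radius centered at zero. For $f(z)=\sum_{n\ge m}a_nz^n$, the operator $A_h^{m,l}$ (Hadamard convolution with $h$ followed by a shift) is $$A_h^{m,l}f(z)=z^l(h*f)(z)=\sum_{n\ge m}c_na_nz^{n+l}.$$ The majorant series of $f$ is $M_rf=\sum_{n\ge m}|a_n|r^n$; applying $A_h^{m,l}$ to it as a power series in $r$ gives $A_h^{m,l}M_rf=\sum_{n\ge m}c_n|a_n|r^{n+l}$. The operator $id_m$ is the identity on the space of analytic functions in $\mathbb{D}$ of the form $\sum_{n\ge m}a_nz^n$. The Bohr--Bombieri function of a pair of linear operators $T_1,T_2$ with initial coefficient $a$ is $$m_{T_1\to T_2}(r,a)=\sup\frac{|T_2M_rf|}{\|T_1f\|_\infty},$$ where the supremum is taken over all functions $f(z)=\sum_{n\ge m}a_nz^n$ such that $\|T_1f\|_\infty\ne 0$ and $|a_m|=a$. Thus $m_{id_m\to A_h^{m,l}}(r,a)$ is the supremum of $\big|\sum_{n\ge m}c_n|a_n|r^{n+l}\big|/\|f\|_\infty$ over all such $f$ with $\|f\|_\infty\neq 0$, $|a_m|=a$.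
   Formalization: Repaired: m(r,a) is taken over ‖f‖=1, |a_m|=a≤1 (m+l≥0 if r=0); the upper bound also needs c_{m+1}r/a ≤ c_{n+m}(r/a)^n for 1≤n<s, else it holds without the 1/c_{m+1}; the last sentence excludes 0<r, a<1, r/a = inf_{n≥m+2} c_n/c_{n+1} < c_{m+1}/c_{m+2}. *)

theory Defs
  imports "HOL-Complex_Analysis.Complex_Analysis"
begin

text \<open>Analytic functions on the unit disk of the form \<open>\<Sum>n\<ge>m. a\<^sub>n z\<^sup>n\<close>; the coefficient
  \<open>a\<^sub>n\<close> of \<open>f\<close> is \<open>fps_nth (fps_expansion f 0) n\<close>.\<close>

definition analytic_from :: "nat \<Rightarrow> (complex \<Rightarrow> complex) set" where
  "analytic_from m =
     {f. f holomorphic_on ball 0 1 \<and> (\<forall>n<m. fps_nth (fps_expansion f 0) n = 0)}"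

definition disk_norm :: "(complex \<Rightarrow> complex) \<Rightarrow> ereal" where
  "disk_norm f = (SUP z\<in>ball 0 1. ereal (cmod (f z)))"

text \<open>The majorant series \<open>M\<^sub>r f\<close> is \<open>majorant m f\<close> at the point \<open>r\<close>. It is kept as a function of a
  complex variable so that operators on analytic functions can be applied to it.\<close>

definition majorant :: "nat \<Rightarrow> (complex \<Rightarrow> complex) \<Rightarrow> complex \<Rightarrow> complex" where
  "majorant m f z =
     (\<Sum>n. complex_of_real (cmod (fps_nth (fps_expansion f 0) (n + m))) * z ^ (n + m))"

text \<open>The factor \<open>z\<^sup>l\<close> is kept inside the sum: for \<open>l < 0\<close> the terms with \<open>n + l \<ge> 0\<close>
  have a value at \<open>z = 0\<close>, whereas \<open>0 powi l = 0\<close> would wipe them out.\<close>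

definition hadamard_shift ::
  "real fps \<Rightarrow> nat \<Rightarrow> int \<Rightarrow> (complex \<Rightarrow> complex) \<Rightarrow> complex \<Rightarrow> complex" where
  "hadamard_shift h m l f z =
     (\<Sum>n. complex_of_real (fps_nth h (n + m)) * fps_nth (fps_expansion f 0) (n + m)
            * z powi (int (n + m) + l))"

text \<open>The initial coefficient is measured relative to \<open>disk_norm (T\<^sub>1 f)\<close>; for linear \<open>T\<^sub>1\<close>, \<open>T\<^sub>2\<close>
  this is the same as taking \<open>disk_norm (T\<^sub>1 f) = 1\<close> and \<open>\<bar>a\<^sub>m\<bar> = a\<close>. Without such a normalization
  the quotient is invariant under scaling of \<open>f\<close>, and the supremum would not depend on
  \<open>a > 0\<close> at all.\<close>

definition bohr_bombieri ::
  "nat \<Rightarrow> ((complex \<Rightarrow> complex) \<Rightarrow> complex \<Rightarrow> complex) \<Rightarrow>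
   ((complex \<Rightarrow> complex) \<Rightarrow> complex \<Rightarrow> complex) \<Rightarrow> real \<Rightarrow> real \<Rightarrow> ereal" where
  "bohr_bombieri m T\<^sub>1 T\<^sub>2 r a =
     (SUP f\<in>{f \<in> analytic_from m. disk_norm (T\<^sub>1 f) \<noteq> 0 \<and> disk_norm (T\<^sub>1 f) \<noteq> \<infinity> \<and>
               ereal (cmod (fps_nth (fps_expansion f 0) m)) = ereal a * disk_norm (T\<^sub>1 f)}.
        ereal (cmod (T\<^sub>2 (majorant m f) (complex_of_real r))) / disk_norm (T\<^sub>1 f))"

end

theory Submission
  imports Defs
begin

text \<open>Divide \<open>f\<close> by \<open>z\<^sup>m\<close> and by its norm, let \<open>b\<^sub>n\<close> be the resulting coefficients, so that \<open>\<bar>b\<^sub>0\<bar> = a\<close>,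
  and put \<open>e\<^sub>n = c\<^bsub>n+m\<^esub> (r/a)\<^sup>n\<close>. The lower bound comes from the Moebius map \<open>(a - z) / (1 - a z)\<close>,
  for which \<open>\<bar>b\<^sub>n\<bar> = (1 - a\<^sup>2) a\<^bsup>n-1\<^esup>\<close>. By Rogosinski's inequality the partial sums of \<open>\<bar>b\<^sub>n\<bar>\<^sup>2\<close>, \<open>n \<ge> 1\<close>,
  are largest for this map; by Abel summation the same holds for the sums weighted by a nonincreasing
  sequence, in particular by \<open>e\<^sub>n\<close> with the values for \<open>n < s\<close> raised to \<open>e\<^sub>s\<close>. The upper bound follows from
  the Cauchy--Schwarz inequality \<open>(\<Sum> e\<^sub>n a\<^sup>n \<bar>b\<^sub>n\<bar>)\<^sup>2 \<le> (\<Sum> e\<^sub>n \<bar>b\<^sub>n\<bar>\<^sup>2) (\<Sum> e\<^sub>n a\<^bsup>2n\<^esup>)\<close>.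

  Rogosinski's inequality itself is obtained from the fact that multiplication by a function bounded by 1
  does not increase \<open>\<Sum>\<^bsub>n<N\<^esub> \<bar>F\<^sub>n\<bar>\<^sup>2\<close> for any formal power series \<open>F\<close>.\<close>

section \<open>Discrete Parseval identity and multiplication by bounded analytic functions\<close>

text \<open>The characters of the cyclic group of order \<open>M\<close> are orthogonal. Means over
  roots of unity will stand in for integral means over a circle.\<close>

lemma parseval_roots_of_unity:
  fixes p :: "nat \<Rightarrow> complex"
  assumes "M > 0"
  shows "(\<Sum>k<M. (cmod (\<Sum>n<M. p n * cis (2 * pi * real k / real M) ^ n))\<^sup>2)
           = real M * (\<Sum>n<M. (cmod (p n))\<^sup>2)"
proof -
  define w where "w = (\<lambda>n::nat. cis (2 * pi * real n / real M))"
  have inj: "inj_on w {..<M}" and wM: "\<And>n. n < M \<Longrightarrow> w n ^ M = 1"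
    using Complex.bij_betw_roots_unity[OF assms] unfolding w_def bij_betw_def by auto
  have swap: "w k ^ n = w n ^ k" for k n
    by (simp add: w_def Complex.DeMoivre mult_ac)
  have cnj_w: "cnj (w n) = inverse (w n)" "w n \<noteq> 0" for n
    by (simp_all add: w_def cis_cnj)
  have orth: "(\<Sum>k<M. w n ^ k * cnj (w j ^ k)) = (if n = j then of_nat M else 0)"
    if "n < M" "j < M" for n j
  proof -
    define e where "e = w n / w j"
    have eq: "w n ^ k * cnj (w j ^ k) = e ^ k" for k
      by (simp add: e_def cnj_w divide_inverse power_mult_distrib)
    show ?thesis
    proof (cases "n = j")
      case True
      hence "e = 1" by (simp add: e_def cnj_w)
      then show ?thesis unfolding eq using True by simp
    next
      case False
      hence "e \<noteq> 1" using inj that cnj_w by (auto simp: e_def inj_on_def)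
      moreover have "e ^ M = 1" using wM that by (simp add: e_def power_divide)
      ultimately show ?thesis unfolding eq using False by (simp add: geometric_sum)
    qed
  qed
  have "complex_of_real (\<Sum>k<M. (cmod (\<Sum>n<M. p n * w k ^ n))\<^sup>2)
      = (\<Sum>k<M. (\<Sum>n<M. p n * w n ^ k) * cnj (\<Sum>j<M. p j * w j ^ k))"
    by (simp only: of_real_sum complex_norm_square swap)
  also have "\<dots> = (\<Sum>k<M. \<Sum>n<M. \<Sum>j<M. p n * cnj (p j) * (w n ^ k * cnj (w j ^ k)))"
    by (simp add: sum_product mult_ac)
  also have "\<dots> = (\<Sum>n<M. \<Sum>j<M. \<Sum>k<M. p n * cnj (p j) * (w n ^ k * cnj (w j ^ k)))"
    by (subst sum.swap, subst (2) sum.swap) simp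
  also have "\<dots> = (\<Sum>n<M. \<Sum>j<M. if n = j then p n * cnj (p j) * of_nat M else 0)"
    by (intro sum.cong refl) (simp add: sum_distrib_left[symmetric] orth del: complex_cnj_power)
  also have "\<dots> = complex_of_real (real M * (\<Sum>n<M. (cmod (p n))\<^sup>2))"
    by (simp add: sum_distrib_left mult_ac complex_norm_square del: of_real_power)
  finally show ?thesis unfolding w_def of_real_eq_iff .
qed

text \<open>Squared l2 norm of a truncation. Being purely formal, it also applies to multipliers
  such as inverses of power series, whatever their radius of convergence.\<close>

definition energy :: "nat \<Rightarrow> complex fps \<Rightarrow> real" where
  "energy N F = (\<Sum>n<N. (cmod (fps_nth F n))\<^sup>2)"

text \<open>The first \<open>N\<close> coefficients of the product see only the first
  \<open>N\<close> of \<open>F\<close>, so \<open>F\<close> may be replaced by a polynomial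
  \<open>P\<close>. On a circle of radius below 1 the mean of the squared modulus of
  \<open>f P\<close> is at most \<open>C^2\<close> times that of \<open>P\<close>, and Parseval
  turns both means into coefficient sums.\<close>

lemma energy_mult_bounded_analytic:
  fixes f :: "complex \<Rightarrow> complex" and F :: "complex fps"
  assumes holo: "f holomorphic_on ball 0 1" and bound: "\<And>z. z \<in> ball 0 1 \<Longrightarrow> cmod (f z) \<le> C"
  shows "energy N (fps_expansion f 0 * F) \<le> C\<^sup>2 * energy N F"
proof -
  have C0: "C \<ge> 0" using bound[of 0] norm_ge_zero[of "f 0"] by (simp del: norm_ge_zero)
  define P where "P = (\<lambda>z. \<Sum>n<N. fps_nth F n * z ^ n)"
  define L where "L = (\<Sum>n<N. cmod (fps_nth F n))"
  define G where "G = fps_expansion f 0 * fps_cutoff N F"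
  have fexp: "f has_fps_expansion fps_expansion f 0"
    by (rule has_fps_expansion_fps_expansion[OF _ _ holo]) auto
  have P_exp: "P has_fps_expansion fps_cutoff N F"
  proof -
    have "fps_cutoff N F = (\<Sum>n<N. fps_const (fps_nth F n) * fps_X ^ n)"
      by (rule fps_ext) (simp add: fps_sum_nth if_distrib cong: if_cong)
    thus ?thesis unfolding P_def by (auto intro!: fps_expansion_intros)
  qed
  have G_exp: "(\<lambda>z. f z * P z) has_fps_expansion G"
    unfolding G_def by (intro has_fps_expansion_mult fexp P_exp)
  have holo': "(\<lambda>z. f z * P z) holomorphic_on eball 0 (ereal 1)"
    unfolding P_def using holo by (auto intro!: holomorphic_intros)
  have rad: "fps_conv_radius G \<ge> 1"
    using holomorphic_on_imp_fps_conv_radius_ge[OF G_exp holo'] by (simp add: one_ereal_def)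
  have ineq: "(\<Sum>n<N. (cmod (fps_nth G n) * \<rho> ^ n)\<^sup>2) \<le> C\<^sup>2 * energy N F"
    if \<rho>: "0 < \<rho>" "\<rho> < 1" for \<rho> :: real
  proof -
    have summ: "summable (\<lambda>n. cmod (fps_nth G n) * \<rho> ^ n)"
      using norm_summable_fps[of "complex_of_real \<rho>" G] \<rho> rad
      by (simp add: norm_mult norm_power less_le_trans[of _ 1] one_ereal_def)
    define e where "e = (\<lambda>M. \<Sum>n. cmod (fps_nth G (n + M)) * \<rho> ^ (n + M))"
    have e0: "e M \<ge> 0" for M
      unfolding e_def using \<rho> summable_ignore_initial_segment[OF summ, of M]
      by (intro suminf_nonneg) auto
    have e_lim: "e \<longlonglongrightarrow> 0"
      unfolding e_def using suminf_exist_split2[OF summ] .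
    \<comment> \<open>With \<open>M\<close> sample points Parseval is exact only for degree below
      \<open>M\<close>; this covers \<open>P\<close>, while \<open>G\<close> is cut at
      \<open>M\<close>. The bracket is the resulting error, uniform in the sample point since
      \<open>L\<close> bounds \<open>P\<close>, and it vanishes as \<open>M\<close> grows.\<close>
    have step: "(\<Sum>n<N. (cmod (fps_nth G n) * \<rho> ^ n)\<^sup>2)
           \<le> C\<^sup>2 * energy N F + (2 * C * L * e M + (e M)\<^sup>2)" if M: "M > N" for M
    proof -
      define z where "z = (\<lambda>k::nat. complex_of_real \<rho> * cis (2 * pi * real k / real M))"
      have M0: "M > 0" using M by simp
      have nz: "cmod (z k) = \<rho>" for k using \<rho> by (simp add: z_def norm_mult)
      have avgG: "(\<Sum>k<M. (cmod (\<Sum>n<M. fps_nth G n * z k ^ n))\<^sup>2)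
                    = real M * (\<Sum>n<M. (cmod (fps_nth G n) * \<rho> ^ n)\<^sup>2)"
        using parseval_roots_of_unity[OF M0, of "\<lambda>n. fps_nth G n * of_real \<rho> ^ n"] \<rho>
        by (simp add: z_def power_mult_distrib mult.assoc norm_mult norm_power)
      have Pz: "P (z k) = (\<Sum>n<M. fps_nth (fps_cutoff N F) n * z k ^ n)" for k
        unfolding P_def using M by (intro sum.mono_neutral_cong_left) auto
      have "(\<Sum>k<M. (cmod (P (z k)))\<^sup>2)
                    = real M * (\<Sum>n<M. (cmod (fps_nth (fps_cutoff N F) n) * \<rho> ^ n)\<^sup>2)"
        using parseval_roots_of_unity[OF M0, of "\<lambda>n. fps_nth (fps_cutoff N F) n * of_real \<rho> ^ n"] \<rho>
        unfolding Pz unfolding z_def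
        by (simp add: power_mult_distrib mult.assoc norm_mult norm_power del: fps_cutoff_nth)
      also have "(\<Sum>n<M. (cmod (fps_nth (fps_cutoff N F) n) * \<rho> ^ n)\<^sup>2)
                  = (\<Sum>n<N. (cmod (fps_nth F n) * \<rho> ^ n)\<^sup>2)"
        using M by (intro sum.mono_neutral_cong_right) auto
      also have "\<dots> \<le> energy N F"
        unfolding energy_def using \<rho>
        by (intro sum_mono power_mono mult_left_le power_le_one mult_nonneg_nonneg) auto
      finally have avgP: "(\<Sum>k<M. (cmod (P (z k)))\<^sup>2) \<le> real M * energy N F"
        by (simp add: mult_left_mono)
      have L: "cmod (P (z k)) \<le> L" for k
        unfolding P_def L_def using \<rho>
        by (intro sum_norm_le) (auto simp: norm_mult norm_power nz intro!: mult_left_le power_le_one)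
      have pt: "(cmod (\<Sum>n<M. fps_nth G n * z k ^ n))\<^sup>2
                  \<le> C\<^sup>2 * (cmod (P (z k)))\<^sup>2 + (2 * C * L * e M + (e M)\<^sup>2)" for k
      proof -
        have zz: "ereal (cmod (z k)) < ereal 1" using nz \<rho> by simp
        have sums: "(\<lambda>n. fps_nth G n * z k ^ n) sums (f (z k) * P (z k))"
          by (rule has_fps_expansion_imp_sums_complex[OF G_exp holo' zz])
        have "f (z k) * P (z k) = (\<Sum>n. fps_nth G (n + M) * z k ^ (n + M))
                + (\<Sum>n<M. fps_nth G n * z k ^ n)"
          unfolding sums_unique[OF sums]
          by (rule suminf_split_initial_segment[OF sums_summable[OF sums]])
        hence tail: "f (z k) * P (z k) - (\<Sum>n<M. fps_nth G n * z k ^ n)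
              = (\<Sum>n. fps_nth G (n + M) * z k ^ (n + M))"
          by simp
        have "cmod (\<Sum>n. fps_nth G (n + M) * z k ^ (n + M)) \<le> e M"
          unfolding e_def using summable_ignore_initial_segment[OF summ, of M] nz
          by (intro order.trans[OF summable_norm]) (auto simp: norm_mult norm_power)
        hence "cmod (\<Sum>n<M. fps_nth G n * z k ^ n) \<le> cmod (f (z k) * P (z k)) + e M"
          unfolding tail[symmetric] using norm_triangle_sub norm_minus_commute
          by (smt (verit))
        also have "\<dots> \<le> C * cmod (P (z k)) + e M"
          using bound[of "z k"] zz by (simp add: norm_mult mult_right_mono)
        finally have "(cmod (\<Sum>n<M. fps_nth G n * z k ^ n))\<^sup>2 \<le> (C * cmod (P (z k)) + e M)\<^sup>2"
          by (intro power_mono) auto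
        also have "\<dots> = C\<^sup>2 * (cmod (P (z k)))\<^sup>2 + (2 * C * cmod (P (z k)) * e M + (e M)\<^sup>2)"
          by (simp add: power2_eq_square algebra_simps)
        also have "\<dots> \<le> C\<^sup>2 * (cmod (P (z k)))\<^sup>2 + (2 * C * L * e M + (e M)\<^sup>2)"
          using L[of k] C0 e0[of M] by (simp add: mult_left_mono mult_right_mono)
        finally show ?thesis .
      qed
      have "real M * (\<Sum>n<M. (cmod (fps_nth G n) * \<rho> ^ n)\<^sup>2)
              \<le> (\<Sum>k<M. C\<^sup>2 * (cmod (P (z k)))\<^sup>2 + (2 * C * L * e M + (e M)\<^sup>2))"
        unfolding avgG[symmetric] by (intro sum_mono pt)
      also have "\<dots> = C\<^sup>2 * (\<Sum>k<M. (cmod (P (z k)))\<^sup>2) + real M * (2 * C * L * e M + (e M)\<^sup>2)"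
        by (simp add: sum.distrib sum_distrib_left)
      also have "\<dots> \<le> C\<^sup>2 * (real M * energy N F) + real M * (2 * C * L * e M + (e M)\<^sup>2)"
        by (intro add_right_mono mult_left_mono avgP) auto
      also have "\<dots> = real M * (C\<^sup>2 * energy N F + (2 * C * L * e M + (e M)\<^sup>2))"
        by (simp add: algebra_simps)
      finally have "(\<Sum>n<M. (cmod (fps_nth G n) * \<rho> ^ n)\<^sup>2)
                     \<le> C\<^sup>2 * energy N F + (2 * C * L * e M + (e M)\<^sup>2)"
        using M0 by simp
      moreover have "(\<Sum>n<N. (cmod (fps_nth G n) * \<rho> ^ n)\<^sup>2)
                       \<le> (\<Sum>n<M. (cmod (fps_nth G n) * \<rho> ^ n)\<^sup>2)"
        using M by (intro sum_mono2) auto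
      ultimately show ?thesis by linarith
    qed
    have "(\<lambda>M. C\<^sup>2 * energy N F + (2 * C * L * e M + (e M)\<^sup>2))
            \<longlonglongrightarrow> C\<^sup>2 * energy N F + (2 * C * L * 0 + 0\<^sup>2)"
      by (intro tendsto_intros e_lim)
    hence "(\<lambda>M. C\<^sup>2 * energy N F + (2 * C * L * e M + (e M)\<^sup>2)) \<longlonglongrightarrow> C\<^sup>2 * energy N F"
      by simp
    thus ?thesis
      by (rule LIMSEQ_le_const) (use step in \<open>auto intro!: exI[of _ "Suc N"]\<close>)
  qed
  \<comment> \<open>The sum is finite, so the radius can tend to 1 termwise.\<close>
  have "((\<lambda>\<rho>::real. \<Sum>n<N. (cmod (fps_nth G n) * \<rho> ^ n)\<^sup>2)
          \<longlongrightarrow> (\<Sum>n<N. (cmod (fps_nth G n) * 1 ^ n)\<^sup>2)) (at_left 1)"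
    by (intro tendsto_intros)
  moreover have "eventually (\<lambda>\<rho>::real. (\<Sum>n<N. (cmod (fps_nth G n) * \<rho> ^ n)\<^sup>2) \<le> C\<^sup>2 * energy N F) (at_left 1)"
    using eventually_at_left_real[of 0 "1::real"] by (rule eventually_mono) (auto intro!: ineq)
  ultimately have "(\<Sum>n<N. (cmod (fps_nth G n) * 1 ^ n)\<^sup>2) \<le> C\<^sup>2 * energy N F"
    by (intro tendsto_upperbound) auto
  moreover have "energy N (fps_expansion f 0 * F) = (\<Sum>n<N. (cmod (fps_nth G n) * 1 ^ n)\<^sup>2)"
    unfolding energy_def G_def by (intro sum.cong refl) (simp add: fps_cutoff_right_mult_nth)
  ultimately show ?thesis by simp
qed

section \<open>Rogosinski's inequality for contractive multipliers\<close>

lemma energy_Suc: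
  "energy (Suc N) F = (cmod (fps_nth F 0))\<^sup>2 + (\<Sum>n<N. (cmod (fps_nth F (Suc n)))\<^sup>2)"
  unfolding energy_def by (subst sum.lessThan_Suc_shift) simp

text \<open>A division-free form of Schur's observation that
  \<open>(g - c) / (1 - cnj c * g)\<close> is again contractive: the identity \<open>pt\<close> is
  applied to each pair of coefficients of \<open>F\<close> and \<open>g * F\<close>.\<close>

lemma energy_schur_step:
  assumes contr: "\<And>N F. energy N (g * F) \<le> energy N F" and c: "cmod c \<le> 1"
  shows "energy N ((g - fps_const c) * F) \<le> energy N ((1 - fps_const (cnj c) * g) * F)"
proof -
  have pt: "(cmod (x - cnj c * y))\<^sup>2 - (cmod (y - c * x))\<^sup>2 = (1 - (cmod c)\<^sup>2) * ((cmod x)\<^sup>2 - (cmod y)\<^sup>2)"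
    for x y
    by (simp add: cmod_power2) (simp add: power2_eq_square algebra_simps)
  have "(1 - fps_const (cnj c) * g) * F = F - fps_const (cnj c) * (g * F)"
    and "(g - fps_const c) * F = g * F - fps_const c * F"
    by (simp_all add: algebra_simps)
  hence "energy N ((1 - fps_const (cnj c) * g) * F) - energy N ((g - fps_const c) * F)
          = (1 - (cmod c)\<^sup>2) * (energy N F - energy N (g * F))"
    unfolding energy_def by (simp add: sum_subtractf[symmetric] sum_distrib_left pt)
  moreover have "\<dots> \<ge> 0"
    using contr[of N F] c by (intro mult_nonneg_nonneg) (auto simp: power_le_one)
  ultimately show ?thesis by linarith
qed

text \<open>Let \<open>S_N\<close> be the left-hand side and \<open>c\<close> the constant term of
  \<open>g\<close>. One Schur step gives \<open>S_N\<close> at most the energy of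
  \<open>k = 1 - cnj c * g\<close> below degree \<open>N\<close>, and for \<open>N > 0\<close> this
  equals \<open>(1 - |c|^2)^2 + |c|^2 S_{N-1}\<close>. Iteration produces the geometric sum.\<close>

lemma rogosinski_partial_sums:
  assumes contr: "\<And>N F. energy N (g * F) \<le> energy N F"
  shows "(\<Sum>n<N. (cmod (fps_nth g (Suc n)))\<^sup>2)
           \<le> (1 - (cmod (fps_nth g 0))\<^sup>2)\<^sup>2 * (\<Sum>n<N. (cmod (fps_nth g 0))\<^sup>2 ^ n)"
proof -
  define c where "c = fps_nth g 0"
  define u where "u = g - fps_const c"
  have u0: "fps_nth u 0 = 0" and uS: "fps_nth u (Suc n) = fps_nth g (Suc n)" for n
    by (simp_all add: u_def c_def)
  have tot: "energy N g \<le> energy N 1" for N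
    using contr[of N 1] by simp
  have "(cmod c)\<^sup>2 \<le> 1" using tot[of 1] by (simp add: energy_def c_def)
  hence c1: "cmod c \<le> 1" using power2_le_imp_le[of "cmod c" 1] by simp
  show ?thesis
  proof (cases "cmod c = 1")
    \<comment> \<open>Here \<open>1 - cnj c * g\<close> has zero constant term and is not
      invertible, but the total energy 1 is already used up by \<open>c\<close>, so the higher
      coefficients vanish.\<close>
    case True
    have "energy (Suc N) g \<le> 1"
      using tot[of "Suc N"] by (simp add: energy_Suc)
    thus ?thesis using True by (simp add: energy_Suc c_def)
  next
    case False
    with c1 have c2: "(cmod c)\<^sup>2 < 1" by (simp add: abs_square_less_1)
    define k where "k = 1 - fps_const (cnj c) * g"
    have k0: "fps_nth k 0 = of_real (1 - (cmod c)\<^sup>2)"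
      by (simp add: k_def c_def complex_norm_square mult.commute del: of_real_power)
    hence k00: "fps_nth k 0 \<noteq> 0" using c2 by (auto simp del: of_real_power)
    have kS: "cmod (fps_nth k (Suc n)) = cmod c * cmod (fps_nth g (Suc n))" for n
      by (simp add: k_def norm_mult)
    have rec: "(\<Sum>n<N. (cmod (fps_nth g (Suc n)))\<^sup>2) \<le> energy N k" for N
    proof -
      \<comment> \<open>The multiplier \<open>F\<close> truncates \<open>k\<close> to degree \<open>< N\<close> but leaves the coefficients of \<open>u\<close>
          up to degree \<open>N\<close> unchanged, because \<open>u\<close> has no constant term.\<close>
      define F where "F = inverse k * fps_cutoff N k"
      have kF: "k * F = fps_cutoff N k"
        by (simp add: F_def mult.assoc[symmetric] inverse_mult_eq_1' k00)
      \<comment> \<open>The bracket starts in degree \<open>N\<close>, so \<open>F\<close> agrees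
        with 1 below that degree.\<close>
      have F1: "F = 1 - inverse k * (k - fps_cutoff N k)"
        by (simp add: F_def ring_distribs inverse_mult_eq_1 k00)
      have Fn: "fps_nth F n = fps_nth 1 n" if "n < N" for n
        using that by (auto simp: F1 fps_mult_nth[of "inverse k"] intro!: sum.neutral)
      have "fps_nth (u * F) n = fps_nth u n" if "n \<le> N" for n
      proof -
        have "fps_nth (u * F) n = (\<Sum>i=0..n. fps_nth u i * fps_nth F (n - i))"
          by (simp add: fps_mult_nth)
        also have "\<dots> = (\<Sum>i=0..n. fps_nth u i * fps_nth 1 (n - i))"
        proof (intro sum.cong refl)
          fix i assume "i \<in> {0..n}"
          thus "fps_nth u i * fps_nth F (n - i) = fps_nth u i * fps_nth 1 (n - i)"
            using that by (cases "i = 0") (auto simp: u0 Fn)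
        qed
        also have "\<dots> = fps_nth (u * 1) n"
          by (simp only: fps_mult_nth)
        finally show ?thesis by simp
      qed
      hence "energy (Suc N) (u * F) = energy (Suc N) u"
        unfolding energy_def by (intro sum.cong refl) auto
      moreover have "energy (Suc N) (u * F) \<le> energy (Suc N) (k * F)"
        unfolding u_def k_def by (intro energy_schur_step contr c1)
      moreover have "energy (Suc N) (k * F) = energy N k"
        unfolding kF energy_def by (intro sum.mono_neutral_cong_right) auto
      ultimately show ?thesis by (simp add: energy_Suc u0 uS)
    qed
    show ?thesis unfolding c_def[symmetric]
    proof (induction N)
      case (Suc N)
      have "(\<Sum>n<Suc N. (cmod (fps_nth g (Suc n)))\<^sup>2) \<le> energy (Suc N) k" by (rule rec)
      also have "\<dots> = (1 - (cmod c)\<^sup>2)\<^sup>2 + (cmod c)\<^sup>2 * (\<Sum>n<N. (cmod (fps_nth g (Suc n)))\<^sup>2)"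
        unfolding energy_Suc k0 kS norm_of_real by (simp add: power_mult_distrib sum_distrib_left)
      also have "\<dots> \<le> (1 - (cmod c)\<^sup>2)\<^sup>2 + (cmod c)\<^sup>2 * ((1 - (cmod c)\<^sup>2)\<^sup>2 * (\<Sum>n<N. (cmod c)\<^sup>2 ^ n))"
        using Suc by (intro add_left_mono mult_left_mono) auto
      also have "\<dots> = (1 - (cmod c)\<^sup>2)\<^sup>2 * (\<Sum>n<Suc N. (cmod c)\<^sup>2 ^ n)"
        by (subst sum.lessThan_Suc_shift) (simp add: sum_distrib_left sum_distrib_right algebra_simps)
      finally show ?case .
    qed simp
  qed
qed

text \<open>Abel summation, carried out by induction on the stronger claim that the weighted
  difference dominates the last weight times the plain difference.\<close>

lemma sum_antimono_weights_mono:
  fixes e x y :: "nat \<Rightarrow> real"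
  assumes e: "\<And>n. e n \<ge> 0" "\<And>n. e (Suc n) \<le> e n"
    and le: "\<And>N. (\<Sum>n<N. x n) \<le> (\<Sum>n<N. y n)"
  shows "(\<Sum>n<N. e n * x n) \<le> (\<Sum>n<N. e n * y n)"
proof -
  have "e N * (\<Sum>n<N. y n - x n) \<le> (\<Sum>n<N. e n * (y n - x n))" for N
  proof (induction N)
    case (Suc N)
    have nn: "(\<Sum>n<Suc N. y n - x n) \<ge> 0" using le[of "Suc N"] by (simp add: sum_subtractf)
    have "e (Suc N) * (\<Sum>n<Suc N. y n - x n) \<le> e N * (\<Sum>n<Suc N. y n - x n)"
      by (intro mult_right_mono e nn)
    also have "\<dots> \<le> (\<Sum>n<Suc N. e n * (y n - x n))"
      using Suc by (simp add: algebra_simps)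
    finally show ?case .
  qed simp
  moreover have "e N * (\<Sum>n<N. y n - x n) \<ge> 0"
    using le[of N] e by (intro mult_nonneg_nonneg) (auto simp: sum_subtractf)
  ultimately have "0 \<le> (\<Sum>n<N. e n * (y n - x n))" by (meson order_trans)
  thus ?thesis by (simp add: algebra_simps sum_subtractf)
qed

section \<open>Rogosinski's inequality for analytic functions vanishing to order
  \<open>m\<close>\<close>

lemma energy_shift: "energy (N + m) (fps_X ^ m * F) = energy N F"
proof -
  have "energy (N + m) (fps_X ^ m * F)
          = (\<Sum>n\<in>{m..<N + m}. (cmod (fps_nth F (n - m)))\<^sup>2)"
    unfolding energy_def
    by (intro sum.mono_neutral_cong_right) (auto simp: fps_X_power_mult_nth)
  also have "\<dots> = energy N F"
    unfolding energy_def
    by (intro sum.reindex_bij_witness[of _ "\<lambda>n. n + m" "\<lambda>n. n - m"]) auto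
  finally show ?thesis .
qed

lemma energy_cutoff_mult: "energy N (G * fps_cutoff N F) = energy N (G * F)"
  unfolding energy_def by (intro sum.cong refl) (simp add: fps_cutoff_right_mult_nth)

lemma cmod_le_disk_norm: "disk_norm f = ereal M \<Longrightarrow> z \<in> ball 0 1 \<Longrightarrow> cmod (f z) \<le> M"
  unfolding disk_norm_def by (metis SUP_upper ereal_less_eq(3))

lemma disk_norm_nonneg: "0 \<le> disk_norm f"
proof -
  have "ereal 0 \<le> ereal (cmod (f 0))" by simp
  also have "\<dots> \<le> disk_norm f" unfolding disk_norm_def by (rule SUP_upper) simp
  finally show ?thesis by (simp add: zero_ereal_def)
qed

lemma analytic_from_expansion_eq:
  assumes "f \<in> analytic_from m"
  shows "fps_expansion f 0 = fps_X ^ m * fps_shift m (fps_expansion f 0)"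
  using assms by (intro fps_ext) (auto simp: analytic_from_def fps_X_power_mult_nth)

text \<open>The multiplier bound survives division by \<open>z^m\<close>, because
  \<open>fps_X ^ m\<close> merely shifts coefficients.\<close>

lemma rogosinski_analytic_from:
  assumes f: "f \<in> analytic_from m" and M: "disk_norm f = ereal M" "M > 0"
    and a: "cmod (fps_nth (fps_expansion f 0) m) = a * M"
  shows "(\<Sum>n<N. (cmod (fps_nth (fps_expansion f 0) (Suc n + m)) / M)\<^sup>2)
           \<le> (1 - a\<^sup>2)\<^sup>2 * (\<Sum>n<N. a\<^sup>2 ^ n)"
proof -
  define G where "G = fps_shift m (fps_expansion f 0)"
  define g where "g = fps_const (complex_of_real (1 / M)) * G"
  have G: "fps_expansion f 0 = fps_X ^ m * G"
    unfolding G_def by (rule analytic_from_expansion_eq[OF f])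
  have holo: "f holomorphic_on ball 0 1" using f by (simp add: analytic_from_def)
  have contr: "energy N (g * F) \<le> energy N F" for N F
  proof -
    \<comment> \<open>The shift raises the level to \<open>N + m\<close>; the cutoff keeps
      coefficients of \<open>F\<close> from degree \<open>N\<close> on out of the bound.\<close>
    have "energy N (G * F) = energy (N + m) (fps_expansion f 0 * fps_cutoff N F)"
      by (simp add: G mult.assoc energy_shift energy_cutoff_mult)
    also have "\<dots> \<le> M\<^sup>2 * energy (N + m) (fps_cutoff N F)"
      by (intro energy_mult_bounded_analytic[OF holo] cmod_le_disk_norm[OF M(1)])
    also have "energy (N + m) (fps_cutoff N F) = energy N F"
      unfolding energy_def by (intro sum.mono_neutral_cong_right) auto
    finally have "energy N (G * F) \<le> M\<^sup>2 * energy N F" .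
    moreover have "energy N (g * F) = energy N (G * F) / M\<^sup>2"
      unfolding energy_def g_def mult.assoc fps_mult_left_const_nth sum_divide_distrib
      by (simp add: norm_mult norm_divide power_mult_distrib power_divide)
    ultimately show ?thesis using M(2) by (simp add: divide_le_eq mult.commute)
  qed
  have nth: "cmod (fps_nth g n) = cmod (fps_nth (fps_expansion f 0) (n + m)) / M" for n
    using M(2) by (simp add: g_def G_def norm_mult norm_divide)
  have "cmod (fps_nth g 0) = a" using M(2) by (simp only: nth add_0 a) simp
  thus ?thesis using rogosinski_partial_sums[OF contr, where N = N] by (simp only: nth)
qed

section \<open>Weighted Cauchy--Schwarz estimate\<close>

text \<open>Cauchy--Schwarz with the weights \<open>e n\<close>; the nonincreasing weights needed to
  compare the square sums are obtained by raising \<open>e n\<close> to \<open>e t\<close> for \<open>n < t\<close>,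
  which costs the factor \<open>e t / \<kappa>\<close>.\<close>

lemma weighted_sum_le:
  fixes e x :: "nat \<Rightarrow> real"
  assumes a: "0 \<le> a" "a \<le> 1" and e0: "\<And>n. e n \<ge> 0"
    and dec: "\<And>n. t \<le> n \<Longrightarrow> e (Suc n) \<le> e n"
    and top: "\<And>n. n < t \<Longrightarrow> e n \<le> e t"
    and \<kappa>: "\<kappa> > 0" "\<And>n. n \<le> t \<Longrightarrow> \<kappa> \<le> e n"
    and x: "\<And>N. (\<Sum>n<N. (x n)\<^sup>2) \<le> (1 - a\<^sup>2)\<^sup>2 * (\<Sum>n<N. a\<^sup>2 ^ n)"
  shows "(\<Sum>n<N. e n * a ^ Suc n * x n)
           \<le> sqrt (e t / \<kappa>) * ((1 - a\<^sup>2) * (\<Sum>n<N. e n * a ^ Suc n * a ^ n))"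
proof -
  define e' where "e' = (\<lambda>n. if n < t then e t else e n)"
  define T where "T = (\<Sum>n<N. e n * a\<^sup>2 ^ n)"
  have T0: "T \<ge> 0" unfolding T_def by (intro sum_nonneg) (auto simp: e0)
  have K: "e t / \<kappa> \<ge> 1" using \<kappa>(1) \<kappa>(2)[of t] by simp
  have e'dec: "e' (Suc n) \<le> e' n" for n
  proof -
    consider "Suc n < t" | "Suc n = t" | "t \<le> n" by linarith
    thus ?thesis by cases (auto simp: e'_def dec)
  qed
  have "(\<Sum>n<N. e n * (x n)\<^sup>2) \<le> (\<Sum>n<N. e' n * (x n)\<^sup>2)"
    by (intro sum_mono mult_right_mono) (auto simp: e'_def top)
  also have "\<dots> \<le> (\<Sum>n<N. e' n * ((1 - a\<^sup>2)\<^sup>2 * a\<^sup>2 ^ n))"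
    using x by (intro sum_antimono_weights_mono e'dec)
      (auto simp: e'_def e0 sum_distrib_left)
  also have "\<dots> \<le> (\<Sum>n<N. e t / \<kappa> * e n * ((1 - a\<^sup>2)\<^sup>2 * a\<^sup>2 ^ n))"
  proof (intro sum_mono mult_right_mono)
    fix n
    show "e' n \<le> e t / \<kappa> * e n"
    proof (cases "n < t")
      case True
      hence "e t * \<kappa> \<le> e t * e n" using \<kappa> e0 by (intro mult_left_mono) auto
      thus ?thesis using True \<kappa>(1) by (simp add: e'_def field_simps)
    next
      case False
      thus ?thesis using mult_right_mono[OF K e0[of n]] by (simp add: e'_def)
    qed
  qed auto
  also have "\<dots> = e t / \<kappa> * (1 - a\<^sup>2)\<^sup>2 * T"
    by (simp add: T_def sum_distrib_left sum_divide_distrib mult_ac)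
  finally have sq: "(\<Sum>n<N. e n * (x n)\<^sup>2) \<le> e t / \<kappa> * (1 - a\<^sup>2)\<^sup>2 * T" .
  \<comment> \<open>Splitting each weight into two square roots makes both factors multiples of the
    same sum \<open>T\<close>, so the bound is a perfect square.\<close>
  have "(\<Sum>n<N. e n * a ^ Suc n * x n)\<^sup>2
          = (\<Sum>n<N. (sqrt (e n) * x n) * (sqrt (e n) * a ^ Suc n))\<^sup>2"
    using e0 by (intro arg_cong[of _ _ "\<lambda>u. u\<^sup>2"] sum.cong refl)
      (simp add: mult_ac flip: real_sqrt_mult)
  also have "\<dots> \<le> (\<Sum>n<N. (sqrt (e n) * x n)\<^sup>2) * (\<Sum>n<N. (sqrt (e n) * a ^ Suc n)\<^sup>2)"
    by (rule Cauchy_Schwarz_ineq_sum)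
  also have "(\<Sum>n<N. (sqrt (e n) * x n)\<^sup>2) = (\<Sum>n<N. e n * (x n)\<^sup>2)"
    using e0 by (simp add: power_mult_distrib)
  also have "(\<Sum>n<N. (sqrt (e n) * a ^ Suc n)\<^sup>2) = a\<^sup>2 * T"
    using e0 by (simp add: power_mult_distrib T_def sum_distrib_left mult_ac power_mult[symmetric])
  also have "(\<Sum>n<N. e n * (x n)\<^sup>2) * (a\<^sup>2 * T) \<le> e t / \<kappa> * (1 - a\<^sup>2)\<^sup>2 * T * (a\<^sup>2 * T)"
    using sq T0 by (intro mult_right_mono) auto
  also have "\<dots> = (sqrt (e t / \<kappa>) * ((1 - a\<^sup>2) * (a * T)))\<^sup>2"
    using K by (simp add: power_mult_distrib) (simp add: power2_eq_square)
  finally have "(\<Sum>n<N. e n * a ^ Suc n * x n) \<le> sqrt (e t / \<kappa>) * ((1 - a\<^sup>2) * (a * T))"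
    using a T0 K by (elim power2_le_imp_le) (auto intro!: mult_nonneg_nonneg simp: power_le_one)
  moreover have "a * T = (\<Sum>n<N. e n * a ^ Suc n * a ^ n)"
    by (simp add: T_def sum_distrib_left mult_ac power2_eq_square power_mult_distrib)
  ultimately show ?thesis by simp
qed

section \<open>The operator applied to majorant series\<close>

text \<open>\<open>hadamard_shift\<close> reads the Taylor coefficients of its argument. Taking
  moduli of coefficients keeps the radius of convergence, so the majorant series represents an
  analytic function with these coefficients.\<close>

lemma fps_expansion_majorant:
  assumes f: "f \<in> analytic_from m"
  shows "fps_expansion (majorant m f) 0 = Abs_fps (\<lambda>n. of_real (cmod (fps_nth (fps_expansion f 0) n)))"
    (is "_ = ?A")
proof -
  have "f holomorphic_on eball 0 (ereal 1)" using f by (simp add: analytic_from_def)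
  hence "ereal 1 \<le> fps_conv_radius (fps_expansion f 0)" by (rule conv_radius_fps_expansion)
  moreover have "fps_conv_radius ?A = fps_conv_radius (fps_expansion f 0)"
    unfolding fps_conv_radius_def conv_radius_def by simp
  ultimately have rad: "ereal 1 \<le> fps_conv_radius ?A" by simp
  have low: "fps_nth ?A n = 0" if "n < m" for n
    using f that by (simp add: analytic_from_def)
  have eval: "eval_fps ?A z = majorant m f z" if "z \<in> ball 0 1" for z
  proof -
    have "ereal (cmod z) < fps_conv_radius ?A"
      using that by (intro less_le_trans[OF _ rad]) simp
    from suminf_split_initial_segment[OF summable_fps[OF this], of m]
    show ?thesis using low by (simp add: eval_fps_def majorant_def)
  qed
  have "majorant m f has_fps_expansion ?A"
    unfolding has_fps_expansion_def
  proof
    show "0 < fps_conv_radius ?A" by (rule less_le_trans[OF _ rad]) simp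
    have "eventually (\<lambda>z::complex. z \<in> ball 0 1) (nhds 0)"
      by (intro eventually_nhds_in_open) auto
    thus "eventually (\<lambda>z. eval_fps ?A z = majorant m f z) (nhds 0)"
      by eventually_elim (rule eval)
  qed
  thus ?thesis by (rule fps_expansion_eqI)
qed

text \<open>At \<open>r = 0\<close> with \<open>k < 0\<close> the law fails for
  \<open>n = -k\<close>: the left side is 1, the right side 0.\<close>

lemma power_int_add_nat:
  fixes r :: real
  assumes "r = 0 \<Longrightarrow> 0 \<le> k"
  shows "r powi (int n + k) = r powi k * r ^ n"
proof (cases "r = 0")
  case True
  then obtain j where "k = int j" using assms nonneg_int_cases by blast
  thus ?thesis by (simp flip: of_nat_add add: power_add mult.commute)
qed (simp add: power_int_add mult.commute)

text \<open>All terms are nonnegative, so the modulus is the sum itself. The initial term is split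
  off because the theorem subtracts it.\<close>

lemma cmod_hadamard_shift_majorant:
  assumes f: "f \<in> analytic_from m" and r: "0 \<le> r" "r = 0 \<Longrightarrow> 0 \<le> int m + l"
    and h: "\<And>n. 0 \<le> fps_nth h n"
    and summ: "summable (\<lambda>n. fps_nth h (Suc n + m) * cmod (fps_nth (fps_expansion f 0) (Suc n + m)) * r ^ Suc n)"
  shows "cmod (hadamard_shift h m l (majorant m f) (complex_of_real r))
     = r powi (int m + l) * (fps_nth h m * cmod (fps_nth (fps_expansion f 0) m)
        + (\<Sum>n. fps_nth h (Suc n + m) * cmod (fps_nth (fps_expansion f 0) (Suc n + m)) * r ^ Suc n))"
    (is "_ = ?V")
proof -
  define q where "q = (\<lambda>n. fps_nth h (n + m) * cmod (fps_nth (fps_expansion f 0) (n + m)) * r ^ n)"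
  have summ_q: "summable q" using summ unfolding q_def by (subst summable_Suc_iff[symmetric])
  have "q sums (q 0 + (\<Sum>n. q (Suc n)))"
    using summ_q by (simp add: suminf_split_head summable_sums)
  hence "(\<lambda>n. r powi (int m + l) * q n) sums ?V"
    by (intro sums_mult) (simp add: q_def)
  hence "(\<lambda>n. complex_of_real (r powi (int m + l) * q n)) sums complex_of_real ?V"
    by (rule sums_of_real)
  moreover have term_eq: "complex_of_real (fps_nth h (n + m))
        * fps_nth (fps_expansion (majorant m f) 0) (n + m) * complex_of_real r powi (int (n + m) + l)
      = complex_of_real (r powi (int m + l) * q n)" for n
    using power_int_add_nat[of r "int m + l" n, OF r(2)]
    by (simp add: fps_expansion_majorant[OF f] q_def mult_ac add.assoc flip: of_real_power_int)
  ultimately have "hadamard_shift h m l (majorant m f) (complex_of_real r) = complex_of_real ?V"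
    unfolding hadamard_shift_def term_eq by (simp only: sums_unique[symmetric])
  moreover have "?V \<ge> 0"
    using h r summ by (intro mult_nonneg_nonneg add_nonneg_nonneg suminf_nonneg) auto
  ultimately show ?thesis by (simp only: norm_of_real abs_of_nonneg)
qed

section \<open>The extremal Moebius map\<close>

definition shifted_moebius :: "nat \<Rightarrow> real \<Rightarrow> complex \<Rightarrow> complex" where
  "shifted_moebius m a z = z ^ m * ((of_real a - z) / (1 - of_real a * z))"

lemma one_minus_mult_neq_0:
  assumes "0 \<le> a" "a \<le> 1" "cmod z < 1"
  shows "1 - complex_of_real a * z \<noteq> 0"
proof
  assume "1 - complex_of_real a * z = 0"
  hence "1 = a * cmod z" using assms(1)
    by (metis abs_of_nonneg eq_iff_diff_eq_0 norm_mult norm_of_real norm_one)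
  moreover have "a * cmod z \<le> cmod z" using assms by (intro mult_left_le_one_le) auto
  ultimately show False using assms by simp
qed

lemma fps_expansion_shifted_moebius:
  "fps_expansion (shifted_moebius m a) 0
     = fps_X ^ m * Abs_fps (\<lambda>n. case n of 0 \<Rightarrow> of_real a | Suc k \<Rightarrow> - of_real ((1 - a\<^sup>2) * a ^ k))"
    (is "_ = _ * ?H")
proof -
  \<comment> \<open>Checking the claimed quotient by multiplication: degree 1 gives
    \<open>-(1 - a^2) - a^2 = -1\<close>, and the higher degrees cancel geometrically.\<close>
  have H: "?H * (1 - fps_const (of_real a) * fps_X) = fps_const (of_real a) - fps_X"
  proof (rule fps_ext)
    fix n
    have "fps_nth (?H * (1 - fps_const (of_real a) * fps_X)) n
            = fps_nth ?H n - of_real a * fps_nth (?H * fps_X) n"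
      by (simp add: algebra_simps)
    also have "\<dots> = fps_nth (fps_const (of_real a) - fps_X) n"
      by (cases n; cases "n - 1")
        (auto simp: power2_eq_square algebra_simps)
    finally show "fps_nth (?H * (1 - fps_const (of_real a) * fps_X)) n
            = fps_nth (fps_const (of_real a) - fps_X) n" .
  qed
  have "shifted_moebius m a has_fps_expansion
          fps_X ^ m * ((fps_const (of_real a) - fps_X) / (1 - fps_const (of_real a) * fps_X))"
    unfolding shifted_moebius_def[abs_def] by (intro fps_expansion_intros) auto
  also have "(fps_const (of_real a) - fps_X) / (1 - fps_const (of_real a) * fps_X) = ?H"
    unfolding H[symmetric] by (intro nonzero_mult_div_cancel_right) (auto simp: fps_eq_iff)
  finally show ?thesis by (rule fps_expansion_eqI)
qed

lemma shifted_moebius_analytic_from: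
  assumes "0 \<le> a" "a \<le> 1"
  shows "shifted_moebius m a \<in> analytic_from m"
  unfolding analytic_from_def
proof (intro CollectI conjI allI impI)
  show "shifted_moebius m a holomorphic_on ball 0 1"
    unfolding shifted_moebius_def[abs_def]
    by (intro holomorphic_intros) (use one_minus_mult_neq_0[OF assms] in auto)
qed (simp add: fps_expansion_shifted_moebius fps_X_power_mult_nth)

lemma disk_norm_shifted_moebius:
  assumes a: "0 \<le> a" "a \<le> 1"
  shows "disk_norm (shifted_moebius m a) = 1"
proof (rule antisym)
  show "disk_norm (shifted_moebius m a) \<le> 1"
    unfolding disk_norm_def
  proof (rule SUP_least)
    fix z :: complex assume "z \<in> ball 0 1"
    hence z: "cmod z < 1" by simp
    have "(cmod (1 - of_real a * z))\<^sup>2 - (cmod (of_real a - z))\<^sup>2 = (1 - a\<^sup>2) * (1 - (cmod z)\<^sup>2)"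
      by (simp add: cmod_power2) (simp add: power2_eq_square algebra_simps)
    moreover have "\<dots> \<ge> 0" using a z by (intro mult_nonneg_nonneg) (auto simp: power_le_one)
    ultimately have "(cmod (of_real a - z))\<^sup>2 \<le> (cmod (1 - of_real a * z))\<^sup>2"
      by linarith
    hence "cmod (of_real a - z) \<le> cmod (1 - of_real a * z)"
      by (rule power2_le_imp_le) simp
    hence "cmod (of_real a - z) / cmod (1 - of_real a * z) \<le> 1"
      using one_minus_mult_neq_0[OF a z] by simp
    moreover have "cmod z ^ m \<le> 1" using z by (simp add: power_le_one)
    ultimately have "cmod (shifted_moebius m a z) \<le> 1"
      unfolding shifted_moebius_def norm_mult norm_power norm_divide by (intro mult_le_one) auto
    thus "ereal (cmod (shifted_moebius m a z)) \<le> 1" by (simp add: one_ereal_def)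
  qed
  \<comment> \<open>The value 1 is approached along the negative real axis \<open>z = -t\<close>,
    where the denominator is at least 1, even for \<open>a = 1\<close>.\<close>
  have "((\<lambda>t::real. t ^ m * ((a + t) / (1 + a * t))) \<longlongrightarrow> 1 ^ m * ((a + 1) / (1 + a * 1))) (at_left 1)"
    using a by (intro tendsto_intros) auto
  hence lim: "((\<lambda>t::real. ereal (t ^ m * ((a + t) / (1 + a * t)))) \<longlongrightarrow> 1) (at_left 1)"
    using a by (simp add: one_ereal_def add.commute)
  have "eventually (\<lambda>t::real. ereal (t ^ m * ((a + t) / (1 + a * t))) \<le> disk_norm (shifted_moebius m a)) (at_left 1)"
    using eventually_at_left_real[of 0 "1::real"]
  proof (rule eventually_mono)
    fix t :: real assume t: "t \<in> {0<..<1}"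
    have "shifted_moebius m a (- of_real t) = (-1) ^ m * of_real (t ^ m * ((a + t) / (1 + a * t)))"
      by (simp add: shifted_moebius_def power_minus[of "of_real t"])
    hence "cmod (shifted_moebius m a (- of_real t)) = \<bar>t ^ m * ((a + t) / (1 + a * t))\<bar>"
      by (simp only: norm_mult norm_of_real norm_power norm_minus_cancel norm_one power_one mult_1)
    also have "\<dots> = t ^ m * ((a + t) / (1 + a * t))"
      using a t by (intro abs_of_nonneg) auto
    finally have "ereal (t ^ m * ((a + t) / (1 + a * t))) = ereal (cmod (shifted_moebius m a (- of_real t)))"
      by simp
    also have "\<dots> \<le> disk_norm (shifted_moebius m a)"
      unfolding disk_norm_def using t by (intro SUP_upper) auto
    finally show "ereal (t ^ m * ((a + t) / (1 + a * t))) \<le> disk_norm (shifted_moebius m a)" .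
  qed simp
  thus "1 \<le> disk_norm (shifted_moebius m a)"
    by (intro tendsto_upperbound[OF lim]) auto
qed

section \<open>Two-sided estimate of the Bohr--Bombieri function\<close>

text \<open>The root in the upper bound is the weight \<open>c (m + s) * (r / a) ^ s\<close> over a
  lower bound for the weights with index at most \<open>s\<close>. The condition bounds them below
  by \<open>r / a\<close>; having \<open>c (m + 1)\<close> in the denominator requires the first
  weight to be the least, hence the separate antecedent. The implication in the second alternative
  covers equality of \<open>r / a\<close> with the later infimum, where \<open>inf_le\<close> says
  nothing about the ratio at \<open>m + 1\<close>.\<close>

theorem theorem3:
  fixes m s :: nat and l :: int and r a :: real and c :: "nat \<Rightarrow> real" and h :: "real fps"
  assumes s: "2 \<le> s"
    and r: "0 \<le> r" "r < 1"
    and a: "r < a" "a \<le> 1"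
    and r0: "r = 0 \<Longrightarrow> 0 \<le> int m + l"
    and c_nonneg: "\<And>n. 0 \<le> c n"
    and c_pos: "\<And>n. m + 1 \<le> n \<Longrightarrow> 0 < c n"
    and h: "\<And>n. fps_nth h n = (if m \<le> n then c n else 0)"
    and h_conv: "0 < fps_conv_radius h"
    and cond1: "(\<forall>n. 1 \<le> n \<and> n < s \<longrightarrow>
                    r / a \<le> c (n + m) * (r / a) ^ n \<and>
                    c (n + m) * (r / a) ^ n \<le> c (m + s) * (r / a) ^ s)
                \<or> (s = 2 \<and> c (m + 1) = 1 \<and>
                    (0 < r \<and> a < 1 \<and> r / a = (INF n\<in>{m + 2..}. c n / c (n + 1)) \<longrightarrow>
                       c (m + 1) / c (m + 2) \<le> r / a))"
    and inf_le: "(INF n\<in>{s + m - 1..}. c n / c (n + 1)) \<le> r / a"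
    and le_inf: "r / a \<le> (INF n\<in>{s + m..}. c n / c (n + 1))"
  shows "let B = (1 / a - a) * a powi (- int m) * r powi l
                   * (eval_fps h (a * r) - c m * (a * r) ^ m);
             D = bohr_bombieri m id (hadamard_shift h m l) r a
                   - ereal (r powi (int m + l) * c m * a)
         in ereal B \<le> D
          \<and> ((\<forall>n. 1 \<le> n \<and> n < s \<longrightarrow> c (m + 1) * (r / a) \<le> c (n + m) * (r / a) ^ n) \<longrightarrow>
               D \<le> ereal (sqrt (c (m + s) / c (m + 1) * (r / a) ^ (s - 1)) * B))
          \<and> D \<le> ereal (sqrt (c (m + s) * (r / a) ^ (s - 1)) * B)"
proof -
  define \<rho> where "\<rho> = r / a"
  \<comment> \<open>Indices are lowered by one against the overview: \<open>e n\<close> belongs to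
    the coefficient \<open>n + 1\<close> after division by \<open>z^m\<close>, and the threshold
    \<open>s\<close> becomes \<open>s - 1\<close>.\<close>
  define e where "e = (\<lambda>n. c (Suc n + m) * \<rho> ^ Suc n)"
  define Q where "Q = (\<Sum>n. e n * a ^ Suc n * a ^ n)"
  define w where "w = r powi (int m + l)"
  define B where "B = (1 / a - a) * a powi (- int m) * r powi l * (eval_fps h (a * r) - c m * (a * r) ^ m)"
  define S where "S = bohr_bombieri m id (hadamard_shift h m l) r a"
  have a0: "a > 0" using r(1) a(1) by simp
  have \<rho>0: "\<rho> \<ge> 0" using r(1) a0 by (simp add: \<rho>_def)
  have e0: "e n \<ge> 0" for n using \<rho>0 c_nonneg by (simp add: e_def)
  have w0: "w \<ge> 0" using r(1) by (simp add: w_def)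
  have e_r: "e n * a ^ Suc n = c (Suc n + m) * r ^ Suc n" for n
    using a0 by (simp add: e_def \<rho>_def power_divide del: power_Suc)
  have a2: "0 \<le> 1 - a\<^sup>2" using a0 a(2) by (simp add: power_le_one)
  have bdd: "bdd_below ((\<lambda>n. c n / c (n + 1)) ` A)" for A
    using c_nonneg by (intro bdd_belowI[of _ 0]) auto
  have dec: "e (Suc n) \<le> e n" if "s - 1 \<le> n" for n
  proof -
    have "\<rho> \<le> (INF n\<in>{s + m..}. c n / c (n + 1))" using le_inf by (simp add: \<rho>_def)
    also have "\<dots> \<le> c (Suc n + m) / c (Suc n + m + 1)"
      using that s by (intro cINF_lower bdd) auto
    finally have "c (Suc (Suc n) + m) * \<rho> \<le> c (Suc n + m)"
      using c_pos[of "Suc n + m + 1"] by (simp add: pos_le_divide_eq mult.commute)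
    from mult_right_mono[OF this, of "\<rho> ^ Suc n"] show ?thesis
      using \<rho>0 by (simp add: e_def mult_ac)
  qed
  have summ: "summable (\<lambda>n. e n * a ^ Suc n * a ^ n)" if "a < 1"
  proof (rule summable_comparison_test')
    show "summable (\<lambda>n. e (s - 1) * a ^ n)"
      using a0 that by (intro summable_mult summable_geometric) auto
    fix n assume n: "s - 1 \<le> n"
    have "e n \<le> e (s - 1)"
      using n by (induction n rule: dec_induct) (use dec order_trans in blast)+
    moreover have "a ^ Suc n \<le> 1" using a0 a(2) by (intro power_le_one) auto
    ultimately have "e n * a ^ Suc n \<le> e (s - 1)"
      using e0 mult_mono[of "e n" "e (s - 1)" "a ^ Suc n" 1] a0 by auto
    thus "norm (e n * a ^ Suc n * a ^ n) \<le> e (s - 1) * a ^ n"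
      using e0 a0 by (simp add: abs_mult mult_right_mono del: power_Suc)
  qed
  \<comment> \<open>For \<open>a = 1\<close> the series behind \<open>Q\<close> may diverge, but
    then the factor \<open>1 - a^2\<close> kills every term.\<close>
  have sums_Q: "(\<lambda>n. e n * a ^ Suc n * ((1 - a\<^sup>2) * a ^ n)) sums ((1 - a\<^sup>2) * Q)"
  proof (cases "a < 1")
    case True
    from sums_mult[OF summable_sums[OF summ[OF True]], of "1 - a\<^sup>2"] show ?thesis
      by (simp add: Q_def mult_ac)
  next
    case False
    thus ?thesis using a(2) by simp
  qed
  have B_eq: "B = w * ((1 - a\<^sup>2) * Q)"
  proof (cases "a < 1")
    case True
    have eq: "e n * a ^ Suc n * a ^ n * a * (a * r) ^ m = fps_nth h (Suc n + m) * (a * r) ^ (Suc n + m)" for n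
      unfolding e_r h by (simp add: power_add power_mult_distrib mult_ac)
    have "(\<lambda>n. fps_nth h (Suc n + m) * (a * r) ^ (Suc n + m)) sums (Q * a * (a * r) ^ m)"
      using sums_mult2[OF sums_mult2[OF summable_sums[OF summ[OF True]]], of a "(a * r) ^ m"]
      by (simp only: eq Q_def)
    hence "(\<lambda>n. fps_nth h (n + m) * (a * r) ^ (n + m)) sums (Q * a * (a * r) ^ m + c m * (a * r) ^ m)"
      by (subst (asm) sums_Suc_iff) (simp add: h)
    hence "(\<lambda>n. fps_nth h n * (a * r) ^ n) sums (Q * a * (a * r) ^ m + c m * (a * r) ^ m)"
      by (subst (asm) sums_iff_shift) (simp add: h)
    hence "eval_fps h (a * r) - c m * (a * r) ^ m = Q * a * (a * r) ^ m"
      by (simp add: eval_fps_def sums_iff)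
    hence "B = ((1 / a - a) * a) * (a powi (- int m) * a ^ m) * (r powi l * r ^ m * Q)"
      by (simp add: B_def power_mult_distrib)
    also have "(1 / a - a) * a = 1 - a\<^sup>2" using a0 by (simp add: field_simps power2_eq_square)
    also have "a powi (- int m) * a ^ m = 1" using a0 by (simp add: power_int_minus)
    also have "r powi l * r ^ m * Q = w * Q"
    proof (cases "r = 0")
      case True
      thus ?thesis by (simp add: Q_def e_def \<rho>_def)
    next
      case False
      thus ?thesis by (simp add: w_def power_int_add)
    qed
    finally show ?thesis by simp
  next
    case False
    thus ?thesis using a(2) by (simp add: B_def)
  qed
  have quot: "ereal (cmod (hadamard_shift h m l (majorant m f) (complex_of_real r))) / disk_norm f
        = ereal (w * c m * a + w * (\<Sum>n. e n * a ^ Suc n * (cmod (fps_nth (fps_expansion f 0) (Suc n + m)) / M)))"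
    if f: "f \<in> analytic_from m" and M: "disk_norm f = ereal M" "M > 0"
      and fm: "cmod (fps_nth (fps_expansion f 0) m) = a * M"
      and sm: "summable (\<lambda>n. e n * a ^ Suc n * (cmod (fps_nth (fps_expansion f 0) (Suc n + m)) / M))"
    for f M
  proof -
    define y where "y = (\<lambda>n. e n * a ^ Suc n * (cmod (fps_nth (fps_expansion f 0) (Suc n + m)) / M))"
    have y: "fps_nth h (Suc n + m) * cmod (fps_nth (fps_expansion f 0) (Suc n + m)) * r ^ Suc n = M * y n" for n
      using M(2) unfolding y_def e_r h by (simp del: power_Suc)
    have "summable y" using sm by (simp add: y_def)
    have "cmod (hadamard_shift h m l (majorant m f) (complex_of_real r))
            = w * (c m * (a * M) + M * suminf y)"
      using cmod_hadamard_shift_majorant[OF f r(1) r0, where h = h] \<open>summable y\<close>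
      unfolding y by (simp add: h c_nonneg fm w_def suminf_mult summable_mult)
    thus ?thesis using M unfolding y_def[symmetric] by (simp add: field_simps)
  qed
  \<comment> \<open>The Moebius map has quotient exactly equal to the left side.\<close>
  have lower: "ereal (w * c m * a + B) \<le> S"
  proof -
    define f where "f = shifted_moebius m a"
    have f: "f \<in> analytic_from m" and fn: "disk_norm f = ereal 1"
      using a0 a(2) by (simp_all add: f_def shifted_moebius_analytic_from disk_norm_shifted_moebius one_ereal_def)
    have fm: "cmod (fps_nth (fps_expansion f 0) m) = a * 1"
      using a0 by (simp add: f_def fps_expansion_shifted_moebius fps_X_power_mult_nth)
    have fS: "cmod (fps_nth (fps_expansion f 0) (Suc n + m)) / 1 = (1 - a\<^sup>2) * a ^ n" for n
      using a0 a2
      by (simp add: f_def fps_expansion_shifted_moebius fps_X_power_mult_nth norm_mult norm_power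
               del: of_real_diff of_real_power)
    have "ereal (cmod (hadamard_shift h m l (majorant m f) (complex_of_real r))) / disk_norm f
        = ereal (w * c m * a + B)"
      using quot[OF f fn _ fm] sums_Q unfolding fS by (simp add: B_eq sums_iff)
    thus ?thesis
      unfolding S_def bohr_bombieri_def
      by (intro SUP_upper2[of f]) (use f fn fm in \<open>auto simp: one_ereal_def\<close>)
  qed
  \<comment> \<open>It suffices to bound finite sums over sequences obeying Rogosinski's inequality;
    bounded partial sums also supply the summability that \<open>quot\<close> asks for.\<close>
  have upper: "S \<le> ereal (K * B + w * c m * a)"
    if K: "K \<ge> 0" and le: "\<And>x N. \<lbrakk>\<And>n. x n \<ge> 0; \<And>N. (\<Sum>n<N. (x n)\<^sup>2) \<le> (1 - a\<^sup>2)\<^sup>2 * (\<Sum>n<N. a\<^sup>2 ^ n)\<rbrakk>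
      \<Longrightarrow> (\<Sum>n<N. e n * a ^ Suc n * x n) \<le> K * ((1 - a\<^sup>2) * (\<Sum>n<N. e n * a ^ Suc n * a ^ n))" for K
    unfolding S_def bohr_bombieri_def
  proof (rule SUP_least)
    fix f
    assume "f \<in> {f \<in> analytic_from m. disk_norm (id f) \<noteq> 0 \<and> disk_norm (id f) \<noteq> \<infinity> \<and>
               ereal (cmod (fps_nth (fps_expansion f 0) m)) = ereal a * disk_norm (id f)}"
    hence f: "f \<in> analytic_from m" and nf: "disk_norm f \<noteq> 0" "disk_norm f \<noteq> \<infinity>"
      and fm': "ereal (cmod (fps_nth (fps_expansion f 0) m)) = ereal a * disk_norm f" by auto
    obtain M where M: "disk_norm f = ereal M" "M > 0"
      using nf disk_norm_nonneg[of f] by (cases "disk_norm f") (auto simp: less_le)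
    have fm: "cmod (fps_nth (fps_expansion f 0) m) = a * M" using fm' M by simp
    define x where "x = (\<lambda>n. cmod (fps_nth (fps_expansion f 0) (Suc n + m)) / M)"
    have x0: "x n \<ge> 0" for n using M(2) by (simp add: x_def)
    have sumle: "(\<Sum>n<N. e n * a ^ Suc n * x n) \<le> K * ((1 - a\<^sup>2) * Q)" for N
    proof -
      have "(\<Sum>n<N. e n * a ^ Suc n * x n) \<le> K * ((1 - a\<^sup>2) * (\<Sum>n<N. e n * a ^ Suc n * a ^ n))"
        using rogosinski_analytic_from[OF f M fm] by (intro le x0) (simp add: x_def)
      also have "(1 - a\<^sup>2) * (\<Sum>n<N. e n * a ^ Suc n * a ^ n) = (\<Sum>n<N. e n * a ^ Suc n * ((1 - a\<^sup>2) * a ^ n))"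
        by (simp add: sum_distrib_left mult_ac)
      also have "\<dots> \<le> (\<Sum>n. e n * a ^ Suc n * ((1 - a\<^sup>2) * a ^ n))"
        using e0 a0 a2 by (intro sum_le_suminf sums_summable[OF sums_Q]) auto
      also have "\<dots> = (1 - a\<^sup>2) * Q" by (rule sums_unique[OF sums_Q, symmetric])
      finally show ?thesis using K by (simp add: mult_left_mono)
    qed
    have sm: "summable (\<lambda>n. e n * a ^ Suc n * x n)"
      using e0 a0 x0 sumle by (intro summableI_nonneg_bounded) auto
    have "(\<Sum>n. e n * a ^ Suc n * x n) \<le> K * ((1 - a\<^sup>2) * Q)"
      by (rule suminf_le_const[OF sm sumle])
    hence "w * (\<Sum>n. e n * a ^ Suc n * x n) \<le> K * B"
      using w0 mult_left_mono by (fastforce simp: B_eq mult.left_commute)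
    thus "ereal (cmod (hadamard_shift h m l (majorant m f) (complex_of_real r))) / disk_norm (id f)
            \<le> ereal (K * B + w * c m * a)"
      using quot[OF f M fm] sm unfolding x_def by simp
  qed
  have sm1: "Suc (s - 1) = s" using s by simp
  \<comment> \<open>The comparisons are guarded by \<open>0 < r\<close> and \<open>a < 1\<close>:
    for \<open>r = 0\<close> all weights vanish, and for \<open>a = 1\<close> Rogosinski's
    inequality forces all \<open>x n\<close> to vanish.\<close>
  have upper_\<kappa>: "S \<le> ereal (sqrt (e (s - 1) / \<kappa>) * B + w * c m * a)"
    if \<kappa>: "\<kappa> \<ge> 0" "0 < r \<Longrightarrow> a < 1 \<Longrightarrow> 0 < \<kappa>"
      "\<And>n. 0 < r \<Longrightarrow> a < 1 \<Longrightarrow> n < s - 1 \<Longrightarrow> \<kappa> \<le> e n \<and> e n \<le> e (s - 1)"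
      "0 < r \<Longrightarrow> a < 1 \<Longrightarrow> \<kappa> \<le> e (s - 1)" for \<kappa>
  proof (rule upper)
    fix x :: "nat \<Rightarrow> real" and N
    assume x0: "\<And>n. x n \<ge> 0" and x: "\<And>N. (\<Sum>n<N. (x n)\<^sup>2) \<le> (1 - a\<^sup>2)\<^sup>2 * (\<Sum>n<N. a\<^sup>2 ^ n)"
    consider "r = 0" | "a = 1" | "0 < r" "a < 1" using r a by linarith
    thus "(\<Sum>n<N. e n * a ^ Suc n * x n)
            \<le> sqrt (e (s - 1) / \<kappa>) * ((1 - a\<^sup>2) * (\<Sum>n<N. e n * a ^ Suc n * a ^ n))"
    proof cases
      case 1
      thus ?thesis by (simp add: e_def \<rho>_def)
    next
      case 2
      have "x n = 0" for n
      proof -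
        have "(x n)\<^sup>2 \<le> (\<Sum>n<Suc n. (x n)\<^sup>2)" by (simp add: sum_nonneg)
        also have "\<dots> \<le> 0" using x[of "Suc n"] 2 by simp
        finally show ?thesis by simp
      qed
      thus ?thesis using 2 by simp
    next
      case 3
      thus ?thesis
        using \<kappa> a0 a(2) x by (intro weighted_sum_le e0 dec) (auto simp: le_less)
    qed
  qed (use \<kappa>(1) e0 in auto)
  \<comment> \<open>The second alternative of the hypothesis reduces to the first, except for \<open>r = 0\<close> or \<open>a = 1\<close>.\<close>
  have cond: "\<rho> \<le> e n \<and> e n \<le> e (s - 1)" if ra: "0 < r" "a < 1" and n: "n < s - 1" for n
    using cond1
  proof
    assume "\<forall>n. 1 \<le> n \<and> n < s \<longrightarrow>
                    r / a \<le> c (n + m) * (r / a) ^ n \<and>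
                    c (n + m) * (r / a) ^ n \<le> c (m + s) * (r / a) ^ s"
    from this[rule_format, of "Suc n"] n show ?thesis
      by (simp only: e_def \<rho>_def sm1) (simp add: add.commute)
  next
    assume *: "s = 2 \<and> c (m + 1) = 1 \<and>
                    (0 < r \<and> a < 1 \<and> r / a = (INF n\<in>{m + 2..}. c n / c (n + 1)) \<longrightarrow>
                       c (m + 1) / c (m + 2) \<le> r / a)"
    have sp: "s + m - 1 = m + 1" "s + m = m + 2" using * by auto
    have ins: "{m + 1..} = insert (m + 1) {m + 2..}" by auto
    have "(INF n\<in>{m + 1..}. c n / c (n + 1))
            = min (c (m + 1) / c (m + 2)) (INF n\<in>{m + 2..}. c n / c (n + 1))"
      unfolding ins by (subst cINF_insert[OF _ bdd]) (auto simp: inf_min)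
    hence "min (c (m + 1) / c (m + 2)) (INF n\<in>{m + 2..}. c n / c (n + 1)) \<le> \<rho>"
      using inf_le[unfolded sp(1)] by (simp only: \<rho>_def)
    \<comment> \<open>By \<open>le_inf\<close> the later infimum is at least \<rho>. If it is
      larger, the minimum is the first ratio; if it is equal, the implication in the hypothesis
      applies.\<close>
    hence "c (m + 1) / c (m + 2) \<le> \<rho>"
      using * ra le_inf unfolding sp \<rho>_def by linarith
    hence "1 \<le> \<rho> * c (m + 2)" using * c_pos[of "m + 2"] by (simp add: divide_le_eq)
    from mult_left_mono[OF this \<rho>0] show ?thesis
      using * n by (simp add: e_def power2_eq_square mult_ac)
  qed
  \<comment> \<open>At \<rho> = 0 both sides are 0, by the convention for division by zero and by
    \<open>s >= 2\<close>.\<close>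
  have e_ratio: "e (s - 1) / (k * \<rho>) = c (m + s) / k * \<rho> ^ (s - 1)" for k
  proof (cases "\<rho> = 0")
    case True
    thus ?thesis using s by simp
  next
    case False
    have "\<rho> ^ s = \<rho> ^ (s - 1) * \<rho>" by (metis sm1 power_Suc2)
    moreover have "e (s - 1) = c (m + s) * \<rho> ^ s" by (simp only: e_def sm1 add.commute)
    ultimately show ?thesis using False by simp
  qed
  have \<rho>pos: "0 < \<rho>" if "0 < r" using that a0 by (simp add: \<rho>_def)
  have "S \<le> ereal (sqrt (e (s - 1) / \<rho>) * B + w * c m * a)"
  proof (rule upper_\<kappa>)
    show "\<rho> \<le> e (s - 1)" if "0 < r" "a < 1"
      using cond[OF that, of 0] s by auto
  qed (use \<rho>0 \<rho>pos cond in auto)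
  hence up2: "S \<le> ereal (sqrt (c (m + s) * \<rho> ^ (s - 1)) * B + w * c m * a)"
    using e_ratio[of 1] by simp
  have up1: "S \<le> ereal (sqrt (c (m + s) / c (m + 1) * \<rho> ^ (s - 1)) * B + w * c m * a)"
    if "\<forall>n. 1 \<le> n \<and> n < s \<longrightarrow> c (m + 1) * \<rho> \<le> c (n + m) * \<rho> ^ n"
  proof -
    have \<kappa>_le: "c (m + 1) * \<rho> \<le> e n" if "n < s - 1" for n
      using \<open>\<forall>n. 1 \<le> n \<and> n < s \<longrightarrow> _\<close>[rule_format, of "Suc n"] that
      by (simp add: e_def)
    \<comment> \<open>Here \<kappa> is \<open>e 0\<close>, the least of the weights before
      \<open>s - 1\<close> by the antecedent.\<close>
    have "S \<le> ereal (sqrt (e (s - 1) / (c (m + 1) * \<rho>)) * B + w * c m * a)"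
    proof (rule upper_\<kappa>)
      show "c (m + 1) * \<rho> \<le> e (s - 1)" if "0 < r" "a < 1"
        using cond[OF that, of 0] \<kappa>_le[of 0] s by auto
    qed (use \<rho>0 \<rho>pos cond \<kappa>_le c_nonneg c_pos in auto)
    thus ?thesis unfolding e_ratio .
  qed
  show ?thesis
    unfolding Let_def B_def[symmetric] S_def[symmetric] \<rho>_def[symmetric] w_def[symmetric]
    using lower up1 up2 by (auto simp: ereal_le_minus ereal_minus_le add.commute)
qed

end
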